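(* Let $n>1$. For $0\le\alpha\le n-1$ let $(\mathcal{F}_n,\Delta_{[\alpha]})$ be the coassociative coalgebra with basis $\{U_{ij}: 1\le i,j\le n\}$ and coproduct $\Delta_{[\alpha]}U_{ij}=\sum_{k=1}^n U_{i\,p^\alpha(k)}\otimes U_{kj}$, where $p$ is the cyclic shift on $\{1,\dots,n\}$, and let $Gr(\mathcal{F}_n,\Delta_{[\alpha]})$ be its geometric support with respect to this basis. Then the arrow sets of these geometric supports are pairwise disjoint: $$Gr(\mathcal{F}_n,\Delta_{[\alpha]})_1\cap Gr(\mathcal{F}_n,\Delta_{[\beta]})_1=\emptyset\quad\text{for } 0\le\alpha,\beta\le n-1,\ \alpha\neq\beta,$$ and gluing them yields the $(n^2,1)$-De Bruijn graph: $$\bigcup_{0\le\alpha\le n-1}Gr(\mathcal{F}_n,\Delta_{[\alpha]})=D_{(n^2,1)}.$$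
   Context: The field $k$ is $\mathbb{R}$ or $\mathbb{C}$. $\mathcal{F}_n$ is the $k$-vector space with basis $\{U_{ij}: 1\le i,j\le n\}$. The shift $p:\{1,\dots,n\}\to\{1,\dots,n\}$ sends $j$ to $j+1$ modulo $n$ (so $p(n)=1$). Geometric support: for a vector space $L$ with basis $L_0$ and a coproduct $\Delta:L\to L\otimes L$, the geometric support $Gr(L)$ is the directed graph with vertex set $Gr(L)_0=L_0$ and arrow set $Gr(L)_1$ consisting of the tensors $u\otimes v$ ($u,v\in L_0$) appearing with nonzero coefficient in the coproducts of the elements of $L_0$; the tensor $u\otimes v$ is viewed as an arrow from $u$ to $v$. Gluing (union) of graphs with the same vertex set means taking the union of the arrow sets. The $(m,1)$-De Bruijn graph $D_{(m,1)}$ is the directed graph with $m$ vertices having exactly one arrow from $u$ to $v$ for every ordered pair $(u,v)$ of vertices, including $u=v$. Here the vertices of $D_{(n^2,1)}$ are the $n^2$ elements $U_{ij}$. Graphs are considered up to graph isomorphism. *)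

theory Defs
  imports
    Complex_Main
    "HOL-Library.Poly_Mapping"
    "Graph_Theory.Digraph_Component"
    "Graph_Theory.Digraph_Isomorphism"
begin

section \<open>Free vector spaces and their tensor products\<close>

text \<open>
  The vector space over \<open>'k\<close> with basis \<open>'b\<close> is \<open>'b \<Rightarrow>\<^sub>0 'k\<close>; the basis vector of
  \<open>b\<close> is \<open>Poly_Mapping.single b 1\<close>.  The tensor product of the spaces with bases \<open>'b\<close> and \<open>'c\<close>
  is modelled as the space with basis \<open>'b \<times> 'c\<close>.
\<close>

definition pm_scale :: "'k::field \<Rightarrow> ('b \<Rightarrow>\<^sub>0 'k) \<Rightarrow> ('b \<Rightarrow>\<^sub>0 'k)" where
  "pm_scale c = Poly_Mapping.map ((*) c)"

lemma lookup_pm_scale [simp]: "Poly_Mapping.lookup (pm_scale c x) b = c * Poly_Mapping.lookup x b"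
  by (simp add: pm_scale_def Poly_Mapping.map.rep_eq when_def)

global_interpretation pm: vector_space "pm_scale :: 'k::field \<Rightarrow> ('b \<Rightarrow>\<^sub>0 'k) \<Rightarrow> ('b \<Rightarrow>\<^sub>0 'k)"
  by unfold_locales (auto intro!: poly_mapping_eqI simp: lookup_add algebra_simps)

lift_definition tensor :: "('b \<Rightarrow>\<^sub>0 'k::field) \<Rightarrow> ('c \<Rightarrow>\<^sub>0 'k) \<Rightarrow> ('b \<times> 'c \<Rightarrow>\<^sub>0 'k)"  (infixl \<open>\<otimes>\<^sub>t\<close> 75)
  is "\<lambda>x y (b, c). x b * y c"
proof -
  fix x :: "'b \<Rightarrow> 'k" and y :: "'c \<Rightarrow> 'k"
  assume "finite {b. x b \<noteq> 0}" "finite {c. y c \<noteq> 0}"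
  then have "finite ({b. x b \<noteq> 0} \<times> {c. y c \<noteq> 0})" by simp
  then show "finite {p. (case p of (b, c) \<Rightarrow> x b * y c) \<noteq> 0}"
    by (rule rev_finite_subset) auto
qed

lemma lookup_tensor [simp]:
  "Poly_Mapping.lookup (x \<otimes>\<^sub>t y) p =
    Poly_Mapping.lookup x (fst p) * Poly_Mapping.lookup y (snd p)"
  by transfer (simp add: case_prod_unfold)

lemma tensor_single [simp]:
  "Poly_Mapping.single b s \<otimes>\<^sub>t Poly_Mapping.single c t = Poly_Mapping.single (b, c) (s * t)"
  by (rule poly_mapping_eqI) (auto simp: lookup_single when_def)

text \<open>The linear map determined by its values \<open>g b\<close> on the basis vectors.\<close>

definition lin_ext :: "('b \<Rightarrow> ('c \<Rightarrow>\<^sub>0 'k::field)) \<Rightarrow> ('b \<Rightarrow>\<^sub>0 'k) \<Rightarrow> ('c \<Rightarrow>\<^sub>0 'k)" where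
  "lin_ext g x = (\<Sum>b\<in>Poly_Mapping.keys x. pm_scale (Poly_Mapping.lookup x b) (g b))"

lemma lin_ext_superset:
  assumes "finite B" "Poly_Mapping.keys x \<subseteq> B"
  shows "lin_ext g x = (\<Sum>b\<in>B. pm_scale (Poly_Mapping.lookup x b) (g b))"
  unfolding lin_ext_def using assms
  by (intro sum.mono_neutral_left) (auto simp: in_keys_iff)

lemma linear_lin_ext:
  fixes g :: "'b \<Rightarrow> ('c \<Rightarrow>\<^sub>0 'k::field)"
  shows "Vector_Spaces.linear pm_scale pm_scale (lin_ext g)"
proof unfold_locales
  fix x y :: "'b \<Rightarrow>\<^sub>0 'k"
  let ?B = "Poly_Mapping.keys x \<union> Poly_Mapping.keys y"
  have "Poly_Mapping.keys (x + y) \<subseteq> ?B" by (rule keys_add)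
  then show "lin_ext g (x + y) = lin_ext g x + lin_ext g y"
    by (simp add: lin_ext_superset[of ?B] lookup_add pm.scale_left_distrib sum.distrib)
next
  fix c :: 'k and x :: "'b \<Rightarrow>\<^sub>0 'k"
  have "Poly_Mapping.keys (pm_scale c x) \<subseteq> Poly_Mapping.keys x" by (auto simp: in_keys_iff)
  then show "lin_ext g (pm_scale c x) = pm_scale c (lin_ext g x)"
    by (simp add: lin_ext_superset[of "Poly_Mapping.keys x"] pm.scale_sum_right)
qed

lemma lin_ext_single [simp]: "lin_ext g (Poly_Mapping.single b c) = pm_scale c (g b)"
  by (cases "c = 0") (simp_all add: lin_ext_def)

lemma lin_ext_sum: "lin_ext g (\<Sum>i\<in>I. x i) = (\<Sum>i\<in>I. lin_ext g (x i))"
proof -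
  interpret Vector_Spaces.linear pm_scale pm_scale "lin_ext g" by (rule linear_lin_ext)
  show ?thesis by (rule sum)
qed


section \<open>Geometric support\<close>

text \<open>
  \<open>L\<^sub>0\<close> is a linearly independent set, \<open>L = pm.span L\<^sub>0\<close>, and the tensors \<open>u \<otimes>\<^sub>t v\<close> with
  \<open>u, v \<in> L\<^sub>0\<close> form a basis of \<open>L \<otimes> L\<close>, with respect to which coefficients are taken.
\<close>

definition tensor_basis :: "('b \<Rightarrow>\<^sub>0 'k::field) set \<Rightarrow> ('b \<times> 'b \<Rightarrow>\<^sub>0 'k) set" where
  "tensor_basis L\<^sub>0 = {u \<otimes>\<^sub>t v | u v. u \<in> L\<^sub>0 \<and> v \<in> L\<^sub>0}"

definition geometric_support ::
  "('b \<Rightarrow>\<^sub>0 'k::field) set \<Rightarrow> (('b \<Rightarrow>\<^sub>0 'k) \<Rightarrow> ('b \<times> 'b \<Rightarrow>\<^sub>0 'k))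
     \<Rightarrow> ('b \<Rightarrow>\<^sub>0 'k, 'b \<times> 'b \<Rightarrow>\<^sub>0 'k) pre_digraph" where
  "geometric_support L\<^sub>0 \<Delta> =
     \<lparr> verts = L\<^sub>0,
       arcs = {e \<in> tensor_basis L\<^sub>0. \<exists>w\<in>L\<^sub>0. pm.representation (tensor_basis L\<^sub>0) (\<Delta> w) e \<noteq> 0},
       tail = (\<lambda>e. THE u. u \<in> L\<^sub>0 \<and> (\<exists>v\<in>L\<^sub>0. e = u \<otimes>\<^sub>t v)),
       head = (\<lambda>e. THE v. v \<in> L\<^sub>0 \<and> (\<exists>u\<in>L\<^sub>0. e = u \<otimes>\<^sub>t v)) \<rparr>"


section \<open>The coalgebras on the space with basis \<open>U\<^sub>i\<^sub>j\<close>\<close>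

definition shift :: "nat \<Rightarrow> nat \<Rightarrow> nat" where
  "shift n j = j mod n + 1"

definition U :: "nat \<Rightarrow> nat \<Rightarrow> (nat \<times> nat \<Rightarrow>\<^sub>0 'k::field)" where
  "U i j = Poly_Mapping.single (i, j) 1"

definition F_basis :: "nat \<Rightarrow> (nat \<times> nat \<Rightarrow>\<^sub>0 'k::field) set" where
  "F_basis n = {U i j | i j. i \<in> {1..n} \<and> j \<in> {1..n}}"

text \<open>
  For technical convenience the coproduct is defined on all of \<open>nat \<times> nat \<Rightarrow>\<^sub>0 'k\<close>; it restricts
  to the span of \<open>F_basis n\<close> (lemma \<open>F_coproduct_closed\<close>).
\<close>

definition F_coproduct ::
  "nat \<Rightarrow> nat \<Rightarrow> (nat \<times> nat \<Rightarrow>\<^sub>0 'k::field) \<Rightarrow> ((nat \<times> nat) \<times> (nat \<times> nat) \<Rightarrow>\<^sub>0 'k)" where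
  "F_coproduct n \<alpha> = lin_ext (\<lambda>(i, j). \<Sum>k=1..n. U i ((shift n ^^ \<alpha>) k) \<otimes>\<^sub>t U k j)"

text \<open>The first argument only fixes the base field.\<close>

definition Gr_F ::
  "'k::field itself \<Rightarrow> nat \<Rightarrow> nat
     \<Rightarrow> (nat \<times> nat \<Rightarrow>\<^sub>0 'k, (nat \<times> nat) \<times> (nat \<times> nat) \<Rightarrow>\<^sub>0 'k) pre_digraph" where
  "Gr_F _ n \<alpha> = geometric_support (F_basis n) (F_coproduct n \<alpha>)"

text \<open>
  All the graphs \<open>Gr_F k n \<alpha>\<close> have the same vertices and the same tail and head functions (lemma
  \<open>compatible_Gr_F\<close>).  The library's \<open>Union\<close> takes the last two from its first argument.
\<close>

definition glued_Gr_F ::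
  "'k::field itself \<Rightarrow> nat
     \<Rightarrow> (nat \<times> nat \<Rightarrow>\<^sub>0 'k, (nat \<times> nat) \<times> (nat \<times> nat) \<Rightarrow>\<^sub>0 'k) pre_digraph" where
  "glued_Gr_F k n = pre_digraph.Union (Gr_F k n 0) (Gr_F k n ` {0..n - 1})"

definition de_bruijn1 :: "nat \<Rightarrow> (nat, nat \<times> nat) pre_digraph" where
  "de_bruijn1 m = \<lparr> verts = {..<m}, arcs = {..<m} \<times> {..<m}, tail = fst, head = snd \<rparr>"


section \<open>Basic properties of the definitions\<close>

lemma shift_pow_in:
  assumes "k \<in> {1..n}" shows "(shift n ^^ \<alpha>) k \<in> {1..n}"
  using assms by (induction \<alpha>) (auto simp: shift_def Suc_le_eq)

lemma F_coproduct_U: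
  "F_coproduct n \<alpha> (U i j) = (\<Sum>k=1..n. U i ((shift n ^^ \<alpha>) k) \<otimes>\<^sub>t U k j)"
  unfolding F_coproduct_def by (subst U_def) simp

lemma linear_F_coproduct: "Vector_Spaces.linear pm_scale pm_scale (F_coproduct n \<alpha>)"
  unfolding F_coproduct_def by (rule linear_lin_ext)

lemma F_coproduct_closed:
  assumes "x \<in> pm.span (F_basis n)"
  shows "F_coproduct n \<alpha> x \<in> pm.span (tensor_basis (F_basis n))"
proof -
  interpret l: Vector_Spaces.linear pm_scale pm_scale "F_coproduct n \<alpha> :: (_ \<Rightarrow>\<^sub>0 'a) \<Rightarrow> _"
    by (rule linear_F_coproduct)
  show ?thesis using assms
  proof (induction rule: pm.span_induct_alt)
    case base
    then show ?case by (simp add: l.zero pm.span_zero)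
  next
    case (step c x y)
    then obtain i j where x: "x = U i j" "i \<in> {1..n}" "j \<in> {1..n}"
      by (auto simp: F_basis_def)
    have "F_coproduct n \<alpha> x \<in> pm.span (tensor_basis (F_basis n))"
      unfolding x F_coproduct_U
    proof (intro pm.span_sum pm.span_base)
      fix k assume "k \<in> {1..n}"
      with x shift_pow_in[OF this, of \<alpha>]
      show "U i ((shift n ^^ \<alpha>) k) \<otimes>\<^sub>t U k j \<in> tensor_basis (F_basis n)"
        by (auto simp: tensor_basis_def F_basis_def intro!: exI)
    qed
    with step show ?case by (simp add: l.add l.scale pm.span_add pm.span_scale)
  qed
qed

lemma compatible_Gr_F: "compatible (Gr_F k n \<alpha>) (Gr_F k n \<beta>)"
  and verts_Gr_F: "verts (Gr_F k n \<alpha>) = F_basis n"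
  by (simp_all add: compatible_def Gr_F_def geometric_support_def)

text \<open>Coassociativity: \<open>(\<Delta> \<otimes> id) \<circ> \<Delta> = (id \<otimes> \<Delta>) \<circ> \<Delta>\<close> up to the associator.\<close>

definition tensor_map ::
  "(('a \<Rightarrow>\<^sub>0 'k::field) \<Rightarrow> ('c \<Rightarrow>\<^sub>0 'k)) \<Rightarrow> (('b \<Rightarrow>\<^sub>0 'k) \<Rightarrow> ('d \<Rightarrow>\<^sub>0 'k))
     \<Rightarrow> ('a \<times> 'b \<Rightarrow>\<^sub>0 'k) \<Rightarrow> ('c \<times> 'd \<Rightarrow>\<^sub>0 'k)" where
  "tensor_map f g =
     lin_ext (\<lambda>(a, b). f (Poly_Mapping.single a 1) \<otimes>\<^sub>t g (Poly_Mapping.single b 1))"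

definition tensor_assoc :: "(('a \<times> 'b) \<times> 'c \<Rightarrow>\<^sub>0 'k::field) \<Rightarrow> ('a \<times> ('b \<times> 'c) \<Rightarrow>\<^sub>0 'k)" where
  "tensor_assoc = lin_ext (\<lambda>((a, b), c). Poly_Mapping.single (a, (b, c)) 1)"

lemma tensor_sum_left: "(\<Sum>i\<in>I. x i) \<otimes>\<^sub>t y = (\<Sum>i\<in>I. x i \<otimes>\<^sub>t y)"
  and tensor_sum_right: "y \<otimes>\<^sub>t (\<Sum>i\<in>I. x i) = (\<Sum>i\<in>I. y \<otimes>\<^sub>t x i)"
  by (rule poly_mapping_eqI; simp add: lookup_sum sum_distrib_left sum_distrib_right)+

lemma F_coproduct_coassociative:
  fixes x :: "nat \<times> nat \<Rightarrow>\<^sub>0 'k::field" and n \<alpha> :: nat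
  defines "\<Delta> \<equiv> F_coproduct n \<alpha>"
  shows "tensor_assoc (tensor_map \<Delta> id (\<Delta> x)) = tensor_map id \<Delta> (\<Delta> x)"
proof -
  define l r :: "(nat \<times> nat \<Rightarrow>\<^sub>0 'k) \<Rightarrow> _"
    where "l = (\<lambda>x. tensor_assoc (tensor_map \<Delta> id (\<Delta> x)))" and "r = (\<lambda>x. tensor_map id \<Delta> (\<Delta> x))"
  have D: "\<Delta> (Poly_Mapping.single (i, j) 1) =
      (\<Sum>k=1..n. Poly_Mapping.single ((i, (shift n ^^ \<alpha>) k), (k, j)) 1)" for i j
    using F_coproduct_U[of n \<alpha> i j] by (simp add: \<Delta>_def U_def)
  have "l (Poly_Mapping.single (i, j) 1) = r (Poly_Mapping.single (i, j) 1)" for i j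
  proof -
    let ?q = "shift n ^^ \<alpha>"
    have "l (Poly_Mapping.single (i, j) 1) =
        (\<Sum>k=1..n. \<Sum>m=1..n. Poly_Mapping.single ((i, ?q m), ((m, ?q k), (k, j))) 1)"
      by (simp add: l_def D tensor_map_def tensor_assoc_def lin_ext_sum tensor_sum_left)
    also have "\<dots> = (\<Sum>m=1..n. \<Sum>k=1..n. Poly_Mapping.single ((i, ?q m), ((m, ?q k), (k, j))) 1)"
      by (rule sum.swap)
    also have "\<dots> = r (Poly_Mapping.single (i, j) 1)"
      by (simp add: r_def D tensor_map_def lin_ext_sum tensor_sum_right)
    finally show ?thesis .
  qed
  moreover have "Vector_Spaces.linear pm_scale pm_scale l"
    unfolding l_def tensor_assoc_def tensor_map_def \<Delta>_def F_coproduct_def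
    by (intro Vector_Spaces.linear_compose[OF _ linear_lin_ext, unfolded comp_def] linear_lin_ext)
  moreover have "Vector_Spaces.linear pm_scale pm_scale r"
    unfolding r_def tensor_map_def \<Delta>_def F_coproduct_def
    by (intro Vector_Spaces.linear_compose[OF _ linear_lin_ext, unfolded comp_def] linear_lin_ext)
  moreover have "x = (\<Sum>b\<in>Poly_Mapping.keys x. pm_scale (Poly_Mapping.lookup x b) (Poly_Mapping.single b 1))"
    by (rule poly_mapping_eqI)
      (auto simp: lookup_sum lookup_single when_def in_keys_iff if_distrib cong: if_cong)
  ultimately have "l x = r x"
  proof -
    assume eq: "\<And>i j. l (Poly_Mapping.single (i, j) 1) = r (Poly_Mapping.single (i, j) 1)"
      and l: "Vector_Spaces.linear pm_scale pm_scale l"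
      and r: "Vector_Spaces.linear pm_scale pm_scale r"
      and x: "x = (\<Sum>b\<in>Poly_Mapping.keys x.
        pm_scale (Poly_Mapping.lookup x b) (Poly_Mapping.single b 1))"
    interpret l: Vector_Spaces.linear pm_scale pm_scale l by (rule l)
    interpret r: Vector_Spaces.linear pm_scale pm_scale r by (rule r)
    have "l (Poly_Mapping.single b 1) = r (Poly_Mapping.single b 1)" for b
      using eq by (cases b) simp
    then show ?thesis
      by (subst (1 2) x) (simp add: l.sum r.sum l.scale r.scale)
  qed
  then show ?thesis by (simp add: l_def r_def)
qed

end

theory Submission
  imports Defs "HOL-Number_Theory.Cong"
begin

text \<open>
  A basis tensor \<open>U i l \<otimes>\<^sub>t U k j\<close> is an arrow of the \<open>\<alpha>\<close>-th graph exactly when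
  \<open>l = (shift n ^^ \<alpha>) k\<close> (lemma \<open>arcs_Gr_F\<close>): it then occurs in the coproduct of \<open>U i j\<close>, and no
  cancellation can take place because the summands of that coproduct are pairwise distinct basis
  tensors.  The outer indices \<open>i\<close> and \<open>j\<close> are unconstrained, so everything depends on the two inner
  indices \<open>l\<close> and \<open>k\<close>.

  The cyclic group of shifts acts simply transitively on \<open>{1..n}\<close>: given \<open>k\<close> and \<open>l\<close> there is
  exactly one \<open>\<alpha>\<close> in \<open>{0..n - 1}\<close> that takes \<open>k\<close> to \<open>l\<close> (lemma \<open>bij_betw_shift_pow\<close>).  Hence every
  basis tensor lies in one and only one of the graphs.  Uniqueness gives disjointness, and existence
  says that the arrows of the glued graph are all the tensors of two basis vectors.  A tensor of
  basis vectors determines its factors, so the glued graph has exactly one arrow for each ordered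
  pair of its \<open>n\<^sup>2\<close> vertices, and any numbering of the vertices identifies it with the De Bruijn
  graph (lemma \<open>digraph_iso_de_bruijn1\<close>).

  The argument uses of the base field only that \<open>1 \<noteq> 0\<close>, so both base fields are instances of
  lemmas over an arbitrary field.
\<close>

section \<open>Unit vectors and geometric supports\<close>

lemma single_one_eq_iff:
  "Poly_Mapping.single a (1 :: 'k::field) = Poly_Mapping.single b 1 \<longleftrightarrow> a = b"
  by (metis lookup_single_eq lookup_single_not_eq zero_neq_one)

text \<open>
  Evaluating a linear relation between unit vectors at the index of one of them isolates the
  coefficient of that vector.
\<close>

lemma independent_single:
  "pm.independent ((\<lambda>b. Poly_Mapping.single b (1 :: 'k::field)) ` A)"
  unfolding pm.dependent_explicit
proof (clarify)
  fix S :: "('a \<Rightarrow>\<^sub>0 'k) set" and c :: "('a \<Rightarrow>\<^sub>0 'k) \<Rightarrow> 'k" and v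
  assume fin: "finite S" and sub: "S \<subseteq> (\<lambda>b. Poly_Mapping.single b 1) ` A"
    and v: "v \<in> S" "c v \<noteq> 0" and sum: "(\<Sum>w\<in>S. pm_scale (c w) w) = 0"
  obtain b where b: "v = Poly_Mapping.single b 1" using sub v(1) by auto
  have "c w * Poly_Mapping.lookup w b = (if w = v then c v else 0)" if "w \<in> S" for w
  proof -
    obtain b' where "w = Poly_Mapping.single b' 1" using sub \<open>w \<in> S\<close> by blast
    then show ?thesis by (auto simp: b lookup_single when_def single_one_eq_iff)
  qed
  then have "(\<Sum>w\<in>S. c w * Poly_Mapping.lookup w b) = c v"
    using fin v(1) by (simp add: sum.delta)
  moreover have "(\<Sum>w\<in>S. c w * Poly_Mapping.lookup w b) = 0"
    using arg_cong[OF sum, of "\<lambda>x. Poly_Mapping.lookup x b"] by (simp add: lookup_sum)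
  ultimately show False using v(2) by simp
qed

lemma F_basis_eq: "F_basis n = (\<lambda>b. Poly_Mapping.single b 1) ` ({1..n} \<times> {1..n})"
  unfolding F_basis_def U_def by blast

lemma tensor_basis_eq:
  "tensor_basis ((\<lambda>b. Poly_Mapping.single b (1 :: 'k::field)) ` A)
    = (\<lambda>e. Poly_Mapping.single e 1) ` (A \<times> A)"
  by (force simp: tensor_basis_def)

text \<open>
  Tail and head of an arrow are defined by unique existence of a factorization; over a set of unit
  vectors it holds because the index of a tensor is the pair of the indices of its factors.
\<close>

lemma tail_geometric_support:
  assumes "a \<in> A" "b \<in> A"
  shows "tail (geometric_support ((\<lambda>b. Poly_Mapping.single b 1) ` A) \<Delta>)
           (Poly_Mapping.single (a, b) (1 :: 'k::field)) = Poly_Mapping.single a 1"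
  unfolding geometric_support_def using assms
  by (auto simp: single_one_eq_iff intro!: the_equality)

lemma head_geometric_support:
  assumes "a \<in> A" "b \<in> A"
  shows "head (geometric_support ((\<lambda>b. Poly_Mapping.single b 1) ` A) \<Delta>)
           (Poly_Mapping.single (a, b) (1 :: 'k::field)) = Poly_Mapping.single b 1"
  unfolding geometric_support_def using assms
  by (auto simp: single_one_eq_iff intro!: the_equality)

text \<open>
  Distinctness rules out cancellation: in positive characteristic a basis vector that occurs several
  times in the sum could get the coefficient zero.
\<close>

lemma representation_sum_distinct:
  fixes f :: "'i \<Rightarrow> ('b \<Rightarrow>\<^sub>0 'k::field)"
  assumes "pm.independent B" "finite I" "f ` I \<subseteq> B" "inj_on f I"
  shows "pm.representation B (\<Sum>i\<in>I. f i) e \<noteq> 0 \<longleftrightarrow> e \<in> f ` I"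
proof -
  have "pm.representation B (\<Sum>i\<in>I. f i) e = (\<Sum>i\<in>I. pm.representation B (f i) e)"
    using assms by (subst pm.representation_sum) (auto intro: pm.span_base)
  also have "\<dots> = (\<Sum>i\<in>I. if e = f i then 1 else 0)"
    using assms by (intro sum.cong) (auto simp: pm.representation_basis)
  also have "\<dots> = (\<Sum>x\<in>f ` I. if e = x then 1 else 0)"
    using assms(4) by (simp add: sum.reindex)
  also have "\<dots> = (if e \<in> f ` I then 1 else 0)"
    using assms(2) by (simp add: sum.delta')
  finally show ?thesis by simp
qed

section \<open>Powers of the cyclic shift\<close>

text \<open>
  The indices start at 1, so the shift is addition modulo \<open>n\<close> on the predecessors of the indices.
\<close>

lemma shift_pow:
  assumes "k \<in> {1..n}"
  shows "(shift n ^^ \<alpha>) k = (k - 1 + \<alpha>) mod n + 1"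
proof (induction \<alpha>)
  case 0
  then show ?case using assms by auto
next
  case (Suc \<alpha>)
  then show ?case by (simp add: shift_def mod_Suc_eq)
qed

text \<open>
  Simple transitivity of the cyclic shifts, the combinatorial core of the argument: different
  exponents below \<open>n\<close> move \<open>k\<close> to different places, and there are as many exponents as places.
\<close>

lemma bij_betw_shift_pow:
  assumes k: "k \<in> {1..n}"
  shows "bij_betw (\<lambda>\<alpha>. (shift n ^^ \<alpha>) k) {0..n - 1} {1..n}"
proof -
  have inj: "inj_on (\<lambda>\<alpha>. (shift n ^^ \<alpha>) k) {0..n - 1}"
  proof (rule inj_onI)
    fix \<alpha> \<beta> assume *: "\<alpha> \<in> {0..n - 1}" "\<beta> \<in> {0..n - 1}"
      "(shift n ^^ \<alpha>) k = (shift n ^^ \<beta>) k"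
    then have eq: "[k - 1 + \<alpha> = k - 1 + \<beta>] (mod n)"
      using k by (simp add: shift_pow cong_def)
    from eq have "\<alpha> mod n = \<beta> mod n"
      by (simp only: cong_add_lcancel_nat) (simp add: cong_def)
    then show "\<alpha> = \<beta>" using * k by auto
  qed
  moreover have "(\<lambda>\<alpha>. (shift n ^^ \<alpha>) k) ` {0..n - 1} = {1..n}"
  proof (rule card_subset_eq)
    show "card ((\<lambda>\<alpha>. (shift n ^^ \<alpha>) k) ` {0..n - 1}) = card {1..n}"
      using k by (subst card_image[OF inj]) auto
  qed (use shift_pow_in[OF k] in auto)
  ultimately show ?thesis by (simp add: bij_betw_def)
qed

section \<open>The arrows\<close>

text \<open>
  For fixed \<open>i\<close> and \<open>j\<close> the summands of the coproduct of \<open>U i j\<close> differ in their third index \<open>k\<close>,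
  so each of them has coefficient 1.
\<close>

lemma arcs_Gr_F:
  fixes K :: "'k::field itself"
  shows "arcs (Gr_F K n \<alpha>) =
    {Poly_Mapping.single ((i, (shift n ^^ \<alpha>) k), (k, j)) 1 | i j k.
       i \<in> {1..n} \<and> j \<in> {1..n} \<and> k \<in> {1..n}}"
proof -
  define B :: "((nat \<times> nat) \<times> (nat \<times> nat) \<Rightarrow>\<^sub>0 'k) set" where "B = tensor_basis (F_basis n)"
  have B: "B = (\<lambda>e. Poly_Mapping.single e 1) ` (({1..n} \<times> {1..n}) \<times> ({1..n} \<times> {1..n}))"
    by (simp add: B_def F_basis_eq tensor_basis_eq)
  define t :: "nat \<Rightarrow> nat \<Rightarrow> nat \<Rightarrow> ((nat \<times> nat) \<times> (nat \<times> nat) \<Rightarrow>\<^sub>0 'k)"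
    where "t i j k = Poly_Mapping.single ((i, (shift n ^^ \<alpha>) k), (k, j)) 1" for i j k
  have tB: "t i j ` {1..n} \<subseteq> B" if "i \<in> {1..n}" "j \<in> {1..n}" for i j
    using that shift_pow_in[of _ n \<alpha>] by (auto simp: t_def B simp del: atLeastAtMost_iff)
  have rep: "pm.representation B (F_coproduct n \<alpha> (U i j)) e \<noteq> 0 \<longleftrightarrow> e \<in> t i j ` {1..n}"
    if "i \<in> {1..n}" "j \<in> {1..n}" for i j e
  proof -
    have "F_coproduct n \<alpha> (U i j) = (\<Sum>k=1..n. t i j k)"
      unfolding F_coproduct_U by (simp add: t_def U_def)
    moreover have "inj_on (t i j) {1..n}"
      by (auto simp: inj_on_def t_def single_one_eq_iff)
    moreover have "pm.independent B" unfolding B by (rule independent_single)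
    ultimately show ?thesis using tB[OF that] by (simp add: representation_sum_distinct)
  qed
  have ex: "(\<exists>w\<in>F_basis n. P w) \<longleftrightarrow> (\<exists>i\<in>{1..n}. \<exists>j\<in>{1..n}. P (U i j))"
    for P :: "(nat \<times> nat \<Rightarrow>\<^sub>0 'k) \<Rightarrow> bool"
    unfolding F_basis_def by blast
  have "arcs (Gr_F K n \<alpha>) =
      {e \<in> B. \<exists>i\<in>{1..n}. \<exists>j\<in>{1..n}. pm.representation B (F_coproduct n \<alpha> (U i j)) e \<noteq> 0}"
    by (simp only: Gr_F_def geometric_support_def B_def ex pre_digraph.simps)
  also have "\<dots> = {e \<in> B. \<exists>i\<in>{1..n}. \<exists>j\<in>{1..n}. e \<in> t i j ` {1..n}}"
    by (intro Collect_cong conj_cong bex_cong refl rep)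
  also have "\<dots> = {t i j k | i j k. i \<in> {1..n} \<and> j \<in> {1..n} \<and> k \<in> {1..n}}"
    using tB by blast
  finally show ?thesis by (simp only: t_def)
qed

lemma arcs_Gr_F_disjoint:
  fixes K :: "'k::field itself"
  assumes "\<alpha> \<in> {0..n - 1}" "\<beta> \<in> {0..n - 1}" "\<alpha> \<noteq> \<beta>"
  shows "arcs (Gr_F K n \<alpha>) \<inter> arcs (Gr_F K n \<beta>) = {}"
proof -
  have "e \<notin> arcs (Gr_F K n \<beta>)" if e: "e \<in> arcs (Gr_F K n \<alpha>)" for e
  proof
    assume "e \<in> arcs (Gr_F K n \<beta>)"
    then obtain i j k where b: "e = Poly_Mapping.single ((i, (shift n ^^ \<beta>) k), (k, j)) 1"
      unfolding arcs_Gr_F by blast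
    from e obtain i' j' k'
      where a: "e = Poly_Mapping.single ((i', (shift n ^^ \<alpha>) k'), (k', j')) 1"
        and k': "k' \<in> {1..n}"
      unfolding arcs_Gr_F by blast
    from a b have "((i', (shift n ^^ \<alpha>) k'), (k', j')) = ((i, (shift n ^^ \<beta>) k), (k, j))"
      by (metis single_one_eq_iff)
    then have "(shift n ^^ \<alpha>) k' = (shift n ^^ \<beta>) k'"
      by (elim Pair_inject) simp
    then have "\<alpha> = \<beta>"
      using inj_onD[OF bij_betw_imp_inj_on[OF bij_betw_shift_pow[OF k']] _ assms(1,2)] by blast
    with assms(3) show False ..
  qed
  then show ?thesis by blast
qed

lemma Union_arcs_Gr_F:
  fixes K :: "'k::field itself"
  shows "(\<Union>\<alpha>\<in>{0..n - 1}. arcs (Gr_F K n \<alpha>)) = tensor_basis (F_basis n)"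
proof (intro equalityI subsetI)
  fix e assume "e \<in> (\<Union>\<alpha>\<in>{0..n - 1}. arcs (Gr_F K n \<alpha>))"
  then obtain \<alpha> where "e \<in> arcs (Gr_F K n \<alpha>)" by blast
  then show "e \<in> tensor_basis (F_basis n)" by (simp add: Gr_F_def geometric_support_def)
next
  fix e :: "(nat \<times> nat) \<times> (nat \<times> nat) \<Rightarrow>\<^sub>0 'k"
  assume "e \<in> tensor_basis (F_basis n)"
  then obtain i l k j where e: "e = Poly_Mapping.single ((i, l), (k, j)) 1"
    and range: "i \<in> {1..n}" "l \<in> {1..n}" "k \<in> {1..n}" "j \<in> {1..n}"
    unfolding F_basis_eq tensor_basis_eq by blast
  from range(2) obtain \<alpha> where \<alpha>: "\<alpha> \<in> {0..n - 1}" "l = (shift n ^^ \<alpha>) k"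
    unfolding bij_betw_imp_surj_on[OF bij_betw_shift_pow[OF range(3)], symmetric] by (rule imageE)
  have "e \<in> arcs (Gr_F K n \<alpha>)"
    unfolding arcs_Gr_F e \<alpha>(2) mem_Collect_eq
    by (intro exI[of _ i] exI[of _ j] exI[of _ k]) (use range in simp)
  with \<alpha>(1) show "e \<in> (\<Union>\<alpha>\<in>{0..n - 1}. arcs (Gr_F K n \<alpha>))" by (rule UN_I)
qed

section \<open>The De Bruijn graph\<close>

text \<open>
  When the ends of the arrows determine them and run through all ordered pairs of vertices, a
  numbering \<open>h\<close> of the vertices extends to arrows by sending each to the numbers of its two ends.
\<close>

lemma digraph_iso_de_bruijn1:
  assumes fin: "finite (verts G)"
    and bij: "bij_betw (arc_to_ends G) (arcs G) (verts G \<times> verts G)"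
  shows "digraph_iso G (de_bruijn1 (card (verts G)))"
proof -
  obtain h where h: "bij_betw h (verts G) {..<card (verts G)}"
    using ex_bij_betw_finite_nat[OF fin] unfolding atLeast0LessThan by blast
  define f where "f = \<lparr>iso_verts = h, iso_arcs = map_prod h h \<circ> arc_to_ends G,
    iso_head = snd, iso_tail = fst\<rparr>"
  have ends: "tail G a \<in> verts G" "head G a \<in> verts G" if "a \<in> arcs G" for a
    using bij_betw_apply[OF bij that] by (auto simp: arc_to_ends_def)
  have arcs: "bij_betw (map_prod h h \<circ> arc_to_ends G) (arcs G)
      ({..<card (verts G)} \<times> {..<card (verts G)})"
    using bij_betw_trans[OF bij bij_betw_map_prod[OF h h]] .
  have "wf_digraph G" by unfold_locales (use ends in auto)
  then have "pre_digraph.digraph_isomorphism G f"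
    using bij_betw_imp_inj_on[OF h] bij_betw_imp_inj_on[OF arcs]
    by (simp add: pre_digraph.digraph_isomorphism_def f_def arc_to_ends_def)
  moreover have "de_bruijn1 (card (verts G)) = app_iso f G"
    using bij_betw_imp_surj_on[OF h] bij_betw_imp_surj_on[OF arcs]
    by (simp only: de_bruijn1_def app_iso_def f_def digraph_isomorphism.simps)
  ultimately show ?thesis unfolding digraph_iso_def by blast
qed

lemma glued_Gr_F_iso:
  fixes K :: "'k::field itself"
  shows "verts (glued_Gr_F K n) = F_basis n"
    and "digraph_iso (glued_Gr_F K n) (de_bruijn1 (n\<^sup>2))"
proof -
  let ?G = "glued_Gr_F K n"
  let ?s = "\<lambda>b. Poly_Mapping.single b (1 :: 'k)"
  (* V stays folded below: the simplifier would otherwise split membership in it into inequalities,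
     and the equation ends would no longer apply. *)
  define V where "V = {1..n} \<times> {1..n}"
  have basis: "F_basis n = ?s ` V" by (simp only: F_basis_eq V_def)
  show verts: "verts ?G = F_basis n"
    by (simp add: glued_Gr_F_def pre_digraph.Union_def verts_Gr_F)
  have inj: "inj_on ?s V" by (simp add: inj_on_def single_one_eq_iff)
  have fin: "finite (verts ?G)" by (simp add: verts basis V_def)
  have card: "card (verts ?G) = n\<^sup>2"
    unfolding verts basis by (subst card_image[OF inj]) (simp add: V_def power2_eq_square)
  have arcs: "arcs ?G = (\<lambda>e. Poly_Mapping.single e 1) ` (V \<times> V)"
    using Union_arcs_Gr_F[of K n]
    by (simp add: glued_Gr_F_def pre_digraph.Union_def basis tensor_basis_eq)
  have ends: "arc_to_ends ?G (Poly_Mapping.single (a, b) 1) = (?s a, ?s b)"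
    if "a \<in> V" "b \<in> V" for a b
    unfolding arc_to_ends_def glued_Gr_F_def pre_digraph.Union_def Gr_F_def basis
    using that by (simp add: tail_geometric_support head_geometric_support)
  have "bij_betw (arc_to_ends ?G) (arcs ?G) (verts ?G \<times> verts ?G)"
    unfolding bij_betw_def
  proof
    show "inj_on (arc_to_ends ?G) (arcs ?G)"
      unfolding arcs by (clarsimp simp: inj_on_def ends single_one_eq_iff)
    show "arc_to_ends ?G ` arcs ?G = verts ?G \<times> verts ?G"
    proof -
      have "arc_to_ends ?G ` arcs ?G = (\<lambda>e. arc_to_ends ?G (Poly_Mapping.single e 1)) ` (V \<times> V)"
        by (simp only: arcs image_image)
      also have "\<dots> = map_prod ?s ?s ` (V \<times> V)"
        by (rule image_cong) (auto simp: ends)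
      also have "\<dots> = verts ?G \<times> verts ?G"
        unfolding verts basis by (rule map_prod_surj_on) (rule refl)+
      finally show ?thesis .
    qed
  qed
  from digraph_iso_de_bruijn1[OF fin this] show "digraph_iso ?G (de_bruijn1 (n\<^sup>2))"
    by (simp add: card)
qed

theorem theorem4p5:
  fixes n :: nat
  assumes "n > 1"
  shows
    "((\<forall>\<alpha>\<in>{0..n - 1}. \<forall>\<beta>\<in>{0..n - 1}. \<alpha> \<noteq> \<beta> \<longrightarrow>
         arcs (Gr_F TYPE(real) n \<alpha>) \<inter> arcs (Gr_F TYPE(real) n \<beta>) = {}) \<and>
      verts (glued_Gr_F TYPE(real) n) = F_basis n \<and>
      digraph_iso (glued_Gr_F TYPE(real) n) (de_bruijn1 (n\<^sup>2))) \<and>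
     ((\<forall>\<alpha>\<in>{0..n - 1}. \<forall>\<beta>\<in>{0..n - 1}. \<alpha> \<noteq> \<beta> \<longrightarrow>
         arcs (Gr_F TYPE(complex) n \<alpha>) \<inter> arcs (Gr_F TYPE(complex) n \<beta>) = {}) \<and>
      verts (glued_Gr_F TYPE(complex) n) = F_basis n \<and>
      digraph_iso (glued_Gr_F TYPE(complex) n) (de_bruijn1 (n\<^sup>2)))"
  by (intro conjI ballI impI arcs_Gr_F_disjoint glued_Gr_F_iso)

end
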